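(* Let $Pl_{\Psi}(x)=\{\psi\in\Psi:RB_{\Psi}(\psi\,|\,x)>1\}$ be the plausible region. (i) Among all regions $C$ satisfying $$M(\psi_{*}\notin C(X)\,|\,\psi_{*})\leq M(\psi_{*}\notin Pl_{\Psi}(X)\,|\,\psi_{*})\quad\text{for every }\psi_{*}\in\Psi,$$ the prior probability that $C$ does not cover a value $\psi_{*}$ generated from the prior, namely $$E_{\Pi_{\Psi}}\left(M(\psi_{*}\notin C(X))\right)=\int_{\Psi}M(\psi_{*}\notin C(X))\,\Pi_{\Psi}(d\psi_{*}),$$ is maximized by $C=Pl_{\Psi}$. (ii) Consider the prior probability of not covering a false value, $$\int_{\Psi}\int_{\Psi\backslash\{\psi_{*}\}}M(\psi_{*}\notin C(X)\,|\,\psi)\,\Pi_{\Psi}(d\psi)\,\Pi_{\Psi}(d\psi_{*}).$$ If $\Pi_{\Psi}(\{\psi_{*}\})=0$ for all $\psi_{*}\in\Psi$, then $C=Pl_{\Psi}$ maximizes this quantity among all regions $C$ satisfying $M(\psi_{*}\notin C(X)\,|\,\psi_{*})\leq M(\psi_{*}\notin Pl_{\Psi}(X)\,|\,\psi_{*})$ for every $\psi_{*}$. Otherwise, $C=Pl_{\Psi}$ maximizes this quantity among all regions $C$ satisfying $M(\psi_{*}\notin C(X)\,|\,\psi_{*})=M(\psi_{*}\notin Pl_{\Psi}(X)\,|\,\psi_{*})$ for all $\psi_{*}$.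
   Context: Setting. $\{f_{\theta}:\theta\in\Theta\}$ is a statistical model of probability densities for data $x\in\mathcal{X}$ with respect to a common $\sigma$-finite support measure $\mu$ on $\mathcal{X}$, with $f_\theta(x)$ jointly measurable. $\Pi$ is a proper prior (a probability measure) on $\Theta$. $\Psi:\Theta\rightarrow\Psi$ is a measurable map that is onto (the same symbol denotes the map and its range), and $\psi=\Psi(\theta)$ is the quantity of interest. $\Pi_{\Psi}$ is the marginal prior of $\psi$ (singletons, and the diagonal of $\Psi\times\Psi$, are measurable), and $\Pi(\cdot\,|\,\psi)$ is the conditional prior of $\theta$ given $\Psi(\theta)=\psi$, a regular conditional probability. Prior predictives. $m(x)=\int_{\Theta}f_{\theta}(x)\,\Pi(d\theta)$ is the prior predictive density and $M(B)=\int_{B}m(x)\,\mu(dx)$. The conditional prior predictive density given $\psi$ is $m(x\,|\,\psi)=\int_{\Theta}f_{\theta}(x)\,\Pi(d\theta\,|\,\psi)$, and $M(B\,|\,\psi)=\int_{B}m(x\,|\,\psi)\,\mu(dx)$. Thus $M(B)=\int_{\Psi}M(B\,|\,\psi)\,\Pi_{\Psi}(d\psi)$. Relative belief ratio. $RB_{\Psi}(\psi\,|\,x)$ is the ratio of the posterior density to the prior density of $\psi$, which equals $m(x\,|\,\psi)/m(x)$. The conditions $RB_{\Psi}(\psi\,|\,x)\le 1$, $<1$, $\ge 1$, $>1$ mean respectively $m(x\,|\,\psi)\le m(x)$, $<$, $\ge$, $>$. Regions. A region $C$ assigns to each $x\in\mathcal{X}$ a set $C(x)\subset\Psi$ such that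 $\{(x,\psi):\psi\in C(x)\}$ is measurable in $\mathcal{X}\times\Psi$. Equivalently, $C(x)=\{\psi:x\notin D(\psi)\}$ where $D(\psi)$ is the set of data values not giving evidence in favor of $\psi$ under some evidence rule. Here $M(\psi_{*}\notin C(X)\,|\,\psi)=M(\{x:\psi_{*}\notin C(x)\}\,|\,\psi)$, and similarly for $M(\psi_{*}\notin C(X))$. *)

theory Defs
  imports "HOL-Probability.Probability"
begin

text \<open>
  The parameter space is the space of the prior \<open>\<pi>\<close>, the range of \<open>\<Psi>\<close> is the space of \<open>N\<close>, and
  \<open>K \<psi>\<close> is the conditional prior given \<open>\<Psi>(\<theta>) = \<psi>\<close>. It is an arbitrary version of the regular
  conditional probability, characterised by the disintegration identity.
\<close>

locale relative_belief_model =
  prior: prob_space \<pi> + base: sigma_finite_measure \<mu>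
  for \<mu> :: "'x measure" and \<pi> :: "'t measure" and f :: "'t \<Rightarrow> 'x \<Rightarrow> real"
    and N :: "'p measure" and \<Psi> :: "'t \<Rightarrow> 'p" and K :: "'p \<Rightarrow> 't measure" +
  assumes f_measurable: "(\<lambda>(\<theta>, x). f \<theta> x) \<in> borel_measurable (\<pi> \<Otimes>\<^sub>M \<mu>)"
    and f_nonneg: "\<And>\<theta> x. \<theta> \<in> space \<pi> \<Longrightarrow> x \<in> space \<mu> \<Longrightarrow> 0 \<le> f \<theta> x"
    and f_density: "\<And>\<theta>. \<theta> \<in> space \<pi> \<Longrightarrow> (\<integral>\<^sup>+x. ennreal (f \<theta> x) \<partial>\<mu>) = 1"
    and \<Psi>_measurable: "\<Psi> \<in> measurable \<pi> N"
    and \<Psi>_onto: "\<Psi> ` space \<pi> = space N"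
    and singleton_sets: "\<And>\<psi>. \<psi> \<in> space N \<Longrightarrow> {\<psi>} \<in> sets N"
    and diagonal_sets: "{(\<psi>, \<psi>') \<in> space N \<times> space N. \<psi> = \<psi>'} \<in> sets (N \<Otimes>\<^sub>M N)"
    and K_kernel: "K \<in> measurable N (prob_algebra \<pi>)"
    and K_disintegration: "\<And>A B. A \<in> sets \<pi> \<Longrightarrow> B \<in> sets N \<Longrightarrow>
      emeasure \<pi> (A \<inter> \<Psi> -` B) = (\<integral>\<^sup>+\<psi>\<in>B. emeasure (K \<psi>) A \<partial>distr \<pi> N \<Psi>)"

text \<open>
  For a probability \<open>P\<close> on the parameter space: \<open>P = \<pi>\<close> gives \<open>m(x)\<close> and \<open>M\<close>, and \<open>P = K \<psi>\<close> gives
  \<open>m(x | \<psi>)\<close> and \<open>M(\<cdot> | \<psi>)\<close>.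
\<close>

definition predictive_density :: "('t \<Rightarrow> 'x \<Rightarrow> real) \<Rightarrow> 't measure \<Rightarrow> 'x \<Rightarrow> ennreal" where
  "predictive_density f P x = (\<integral>\<^sup>+\<theta>. ennreal (f \<theta> x) \<partial>P)"

definition predictive :: "'x measure \<Rightarrow> ('t \<Rightarrow> 'x \<Rightarrow> real) \<Rightarrow> 't measure \<Rightarrow> 'x measure" where
  "predictive \<mu> f P = density \<mu> (predictive_density f P)"

definition RB :: "'t measure \<Rightarrow> ('t \<Rightarrow> 'x \<Rightarrow> real) \<Rightarrow> ('p \<Rightarrow> 't measure) \<Rightarrow> 'p \<Rightarrow> 'x \<Rightarrow> ennreal" where
  "RB \<pi> f K \<psi> x = predictive_density f (K \<psi>) x / predictive_density f \<pi> x"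

text \<open>
  The conventions of extended nonnegative division (\<open>0 / 0 = 0\<close>, \<open>a / 0 = \<top>\<close> for \<open>a > 0\<close>, and
  \<open>a / \<top> = 0\<close>) do not affect the condition \<open>RB > 1\<close>:
\<close>

lemma one_less_RB_iff:
  "1 < RB \<pi> f K \<psi> x \<longleftrightarrow> predictive_density f \<pi> x < predictive_density f (K \<psi>) x"
proof -
  have "1 < a / b \<longleftrightarrow> b < a" for a b :: ennreal
  proof (cases "b = 0 \<or> b = \<top>")
    case True
    then show ?thesis
      by (cases "a = 0") (auto simp: divide_ennreal_def ennreal_mult_top zero_less_iff_neq_zero)
  next
    case False
    then obtain r where r: "b = ennreal r" "0 < r"
      by (cases b) (auto simp: less_le)
    show ?thesis
    proof (cases a)
      case (real s)
      then show ?thesis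
        using r by (simp add: divide_ennreal ennreal_less_iff flip: ennreal_1)
    next
      case top
      then show ?thesis using r by (simp add: ennreal_top_divide)
    qed
  qed
  then show ?thesis by (simp add: RB_def)
qed

text \<open>\<open>RB\<close> is the density of the marginal posterior with respect to the marginal prior:\<close>

lemma (in relative_belief_model) RB_posterior_density:
  assumes x: "x \<in> space \<mu>"
    and m: "0 < predictive_density f \<pi> x" "predictive_density f \<pi> x < \<top>"
  shows "distr (density \<pi> (\<lambda>\<theta>. ennreal (f \<theta> x) / predictive_density f \<pi> x)) N \<Psi> =
    density (distr \<pi> N \<Psi>) (\<lambda>\<psi>. RB \<pi> f K \<psi> x)"
proof (rule measure_eqI)
  let ?m = "predictive_density f \<pi> x"
  note [measurable] = \<Psi>_measurable
  have Ks: "K \<in> measurable N (subprob_algebra \<pi>)"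
    by (rule measurable_prob_algebraD[OF K_kernel])
  have fx[measurable]: "(\<lambda>\<theta>. f \<theta> x) \<in> borel_measurable \<pi>"
    using measurable_compose[OF measurable_Pair2'[OF x] f_measurable] by (simp add: case_prod_beta)
  have mc[measurable]: "(\<lambda>\<psi>. predictive_density f (K \<psi>) x) \<in> borel_measurable N"
    unfolding predictive_density_def
    by (rule measurable_compose[OF Ks nn_integral_measurable_subprob_algebra]) simp
  have RBm[measurable]: "(\<lambda>\<psi>. RB \<pi> f K \<psi> x) \<in> borel_measurable N"
    unfolding RB_def by measurable
  fix B assume "B \<in> sets (distr (density \<pi> (\<lambda>\<theta>. ennreal (f \<theta> x) / ?m)) N \<Psi>)"
  then have B[measurable]: "B \<in> sets N" by simp
  let ?D = "density (distr \<pi> N \<Psi>) (indicator B)"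
  have ne: "space ?D \<noteq> {}" using prior.not_empty \<Psi>_onto by auto
  have K': "K \<in> measurable ?D (subprob_algebra \<pi>)" using Ks by simp
  have restr: "density \<pi> (\<lambda>\<theta>. indicator B (\<Psi> \<theta>)) = ?D \<bind> K"
  proof (rule measure_eqI)
    show "sets (density \<pi> (\<lambda>\<theta>. indicator B (\<Psi> \<theta>))) = sets (?D \<bind> K)"
      using sets_bind[OF sets_kernel[OF K'] ne] by simp
    fix A assume "A \<in> sets (density \<pi> (\<lambda>\<theta>. indicator B (\<Psi> \<theta>)))"
    then have A[measurable]: "A \<in> sets \<pi>" by simp
    have ind: "indicator B (\<Psi> \<theta>) * indicator A \<theta> = (indicator (A \<inter> \<Psi> -` B) \<theta> :: ennreal)" for \<theta>
      by (auto simp: indicator_def)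
    have AB: "A \<inter> \<Psi> -` B \<in> sets \<pi>"
    proof -
      have "A \<inter> \<Psi> -` B = A \<inter> (\<Psi> -` B \<inter> space \<pi>)" using sets.sets_into_space[OF A] by auto
      then show ?thesis using measurable_sets[OF \<Psi>_measurable B] A by auto
    qed
    have "emeasure (density \<pi> (\<lambda>\<theta>. indicator B (\<Psi> \<theta>))) A = emeasure \<pi> (A \<inter> \<Psi> -` B)"
      by (subst emeasure_density) (auto simp: ind AB)
    also have "\<dots> = (\<integral>\<^sup>+\<psi>. emeasure (K \<psi>) A * indicator B \<psi> \<partial>distr \<pi> N \<Psi>)"
      by (rule K_disintegration[OF A B])
    also have "\<dots> = (\<integral>\<^sup>+\<psi>. emeasure (K \<psi>) A \<partial>?D)"
      using measurable_compose[OF Ks measurable_emeasure_subprob_algebra[OF A]]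
      by (subst nn_integral_density) (auto simp: mult.commute)
    also have "\<dots> = emeasure (?D \<bind> K) A"
      by (rule emeasure_bind[OF ne K' A, symmetric])
    finally show "emeasure (density \<pi> (\<lambda>\<theta>. indicator B (\<Psi> \<theta>))) A = emeasure (?D \<bind> K) A" .
  qed
  have "emeasure (distr (density \<pi> (\<lambda>\<theta>. ennreal (f \<theta> x) / ?m)) N \<Psi>) B =
      (\<integral>\<^sup>+\<theta>. ennreal (f \<theta> x) / ?m * indicator (\<Psi> -` B \<inter> space \<pi>) \<theta> \<partial>\<pi>)"
    by (subst emeasure_distr) (auto simp: emeasure_density)
  also have "\<dots> = (\<integral>\<^sup>+\<theta>. indicator B (\<Psi> \<theta>) * (ennreal (f \<theta> x) / ?m) \<partial>\<pi>)"
    by (rule nn_integral_cong) (auto simp: indicator_def)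
  also have "\<dots> = (\<integral>\<^sup>+\<theta>. ennreal (f \<theta> x) / ?m \<partial>(?D \<bind> K))"
    unfolding restr[symmetric] by (subst nn_integral_density) auto
  also have "\<dots> = (\<integral>\<^sup>+\<psi>. \<integral>\<^sup>+\<theta>. ennreal (f \<theta> x) / ?m \<partial>K \<psi> \<partial>?D)"
    by (rule nn_integral_bind[OF _ K']) measurable
  also have "\<dots> = (\<integral>\<^sup>+\<psi>. RB \<pi> f K \<psi> x \<partial>?D)"
  proof (rule nn_integral_cong)
    fix \<psi> assume "\<psi> \<in> space ?D"
    then have "sets (K \<psi>) = sets \<pi>" using sets_kernel[OF Ks] by simp
    then have "(\<lambda>\<theta>. ennreal (f \<theta> x)) \<in> borel_measurable (K \<psi>)"
      by (simp cong: measurable_cong_sets)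
    then show "(\<integral>\<^sup>+\<theta>. ennreal (f \<theta> x) / ?m \<partial>K \<psi>) = RB \<pi> f K \<psi> x"
      by (simp add: RB_def predictive_density_def nn_integral_divide)
  qed
  also have "\<dots> = emeasure (density (distr \<pi> N \<Psi>) (\<lambda>\<psi>. RB \<pi> f K \<psi> x)) B"
    by (subst nn_integral_density) (auto simp: emeasure_density mult.commute)
  finally show "emeasure (distr (density \<pi> (\<lambda>\<theta>. ennreal (f \<theta> x) / ?m)) N \<Psi>) B =
    emeasure (density (distr \<pi> N \<Psi>) (\<lambda>\<psi>. RB \<pi> f K \<psi> x)) B" .
qed simp

definition plausible_region ::
  "'t measure \<Rightarrow> ('t \<Rightarrow> 'x \<Rightarrow> real) \<Rightarrow> 'p measure \<Rightarrow> ('p \<Rightarrow> 't measure) \<Rightarrow> 'x \<Rightarrow> 'p set" where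
  "plausible_region \<pi> f N K x = {\<psi> \<in> space N. RB \<pi> f K \<psi> x > 1}"

definition is_region :: "'x measure \<Rightarrow> 'p measure \<Rightarrow> ('x \<Rightarrow> 'p set) \<Rightarrow> bool" where
  "is_region \<mu> N C \<longleftrightarrow> (\<forall>x\<in>space \<mu>. C x \<subseteq> space N) \<and>
     {(x, \<psi>) \<in> space \<mu> \<times> space N. \<psi> \<in> C x} \<in> sets (\<mu> \<Otimes>\<^sub>M N)"

text \<open>
  \<open>noncover \<mu> f P C \<psi>'\<close> is \<open>M(\<psi>' \<notin> C(X))\<close> for \<open>P = \<pi>\<close> and \<open>M(\<psi>' \<notin> C(X) | \<psi>)\<close> for \<open>P = K \<psi>\<close>.
\<close>

definition noncover ::
  "'x measure \<Rightarrow> ('t \<Rightarrow> 'x \<Rightarrow> real) \<Rightarrow> 't measure \<Rightarrow> ('x \<Rightarrow> 'p set) \<Rightarrow> 'p \<Rightarrow> ennreal" where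
  "noncover \<mu> f P C \<psi>' = emeasure (predictive \<mu> f P) {x \<in> space \<mu>. \<psi>' \<notin> C x}"

definition prior_noncover ::
  "'x measure \<Rightarrow> 't measure \<Rightarrow> ('t \<Rightarrow> 'x \<Rightarrow> real) \<Rightarrow> 'p measure \<Rightarrow> ('t \<Rightarrow> 'p) \<Rightarrow>
    ('x \<Rightarrow> 'p set) \<Rightarrow> ennreal" where
  "prior_noncover \<mu> \<pi> f N \<Psi> C = (\<integral>\<^sup>+\<psi>'. noncover \<mu> f \<pi> C \<psi>' \<partial>distr \<pi> N \<Psi>)"

definition prior_noncover_false ::
  "'x measure \<Rightarrow> 't measure \<Rightarrow> ('t \<Rightarrow> 'x \<Rightarrow> real) \<Rightarrow> 'p measure \<Rightarrow> ('t \<Rightarrow> 'p) \<Rightarrow>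
    ('p \<Rightarrow> 't measure) \<Rightarrow> ('x \<Rightarrow> 'p set) \<Rightarrow> ennreal" where
  "prior_noncover_false \<mu> \<pi> f N \<Psi> K C =
    (\<integral>\<^sup>+\<psi>'. (\<integral>\<^sup>+\<psi>\<in>space N - {\<psi>'}. noncover \<mu> f (K \<psi>) C \<psi>' \<partial>distr \<pi> N \<Psi>) \<partial>distr \<pi> N \<Psi>)"

end

theory Submission
  imports Defs
begin

text \<open>
  For a fixed \<open>\<psi>'\<close>, the set of data whose plausible region misses \<open>\<psi>'\<close> is the likelihood ratio
  region \<open>m(x | \<psi>') \<le> m(x)\<close>, so by the Neyman--Pearson argument it has the largest \<open>M\<close>-probability
  among all sets whose \<open>M(\<cdot> | \<psi>')\<close>-probability is not larger. This holds for each \<open>\<psi>'\<close> separately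
  and (i) follows by integration. For (ii), the disintegration of the prior shows that the inner
  integral is \<open>M(\<psi>' \<notin> C(X))\<close> minus \<open>\<Pi>\<^sub>\<Psi>({\<psi>'}) M(\<psi>' \<notin> C(X) | \<psi>')\<close>, and the subtracted term
  is the same for \<open>C\<close> and the plausible region: it is zero in the first case, and the constraint is
  an equality in the second.
\<close>

text \<open>The common part \<open>A \<inter> B\<close> counts equally on both sides, so only the
  two differences matter. On \<open>A - B\<close> the density \<open>p\<close> lies below
  \<open>q\<close>, and on \<open>B - A\<close> it is at least \<open>q\<close>; the size constraint
  under \<open>q\<close> links the two differences.\<close>

lemma neyman_pearson_le:
  fixes p q :: "'a \<Rightarrow> ennreal"
  assumes [measurable]: "p \<in> borel_measurable M" "q \<in> borel_measurable M"
    and [measurable]: "A \<in> sets M" "B \<in> sets M"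
    and B: "\<And>x. x \<in> space M \<Longrightarrow> x \<in> B \<longleftrightarrow> q x \<le> p x"
    and le: "emeasure (density M q) A \<le> emeasure (density M q) B"
    and fin: "emeasure (density M q) B < \<top>"
  shows "emeasure (density M p) A \<le> emeasure (density M p) B"
proof -
  \<comment> \<open>Left general in \<open>r\<close>, \<open>S\<close> and \<open>T\<close>, so that
    it decomposes both \<open>A\<close> and \<open>B\<close> under both densities.\<close>
  have split: "emeasure (density M r) S =
      emeasure (density M r) (S - T) + emeasure (density M r) (A \<inter> B)"
    if "S \<inter> T = A \<inter> B" "S \<in> sets M" "T \<in> sets M" for r S T
  proof -
    have "(S - T) \<inter> (A \<inter> B) = {}" and S: "(S - T) \<union> (A \<inter> B) = S" using that by auto
    then have "emeasure (density M r) (S - T) + emeasure (density M r) (A \<inter> B) =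
        emeasure (density M r) ((S - T) \<union> (A \<inter> B))"
      using that by (intro plus_emeasure) auto
    then show ?thesis unfolding S ..
  qed
  have "emeasure (density M q) (A \<inter> B) \<le> emeasure (density M q) B"
    by (rule emeasure_mono) auto
  with fin have fin': "emeasure (density M q) (A \<inter> B) \<noteq> \<top>" by auto
  have "emeasure (density M p) (A - B) \<le> emeasure (density M q) (A - B)"
    using B by (auto simp: emeasure_density less_imp_le not_le indicator_def intro!: nn_integral_mono)
  \<comment> \<open>The common part is cancelled from both sides of \<open>le\<close>, which in
    \<open>ennreal\<close> is valid because it is finite.\<close>
  also have "\<dots> \<le> emeasure (density M q) (B - A)"
    using le fin' split[of A B q] split[of B A q]
    by (auto simp: add.commute[of _ "emeasure (density M q) (A \<inter> B)"] Int_commute)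
  also have "\<dots> \<le> emeasure (density M p) (B - A)"
    using B by (auto simp: emeasure_density indicator_def intro!: nn_integral_mono)
  finally show ?thesis
    using split[of A B p] split[of B A p] by (auto simp: Int_commute intro: add_right_mono)
qed

context relative_belief_model
begin

lemma K_subprob: "K \<in> measurable N (subprob_algebra \<pi>)"
  by (rule measurable_prob_algebraD[OF K_kernel])

lemma prob_space_K: "\<psi> \<in> space N \<Longrightarrow> prob_space (K \<psi>)"
  and sets_K: "\<psi> \<in> space N \<Longrightarrow> sets (K \<psi>) = sets \<pi>"
  using measurable_space[OF K_kernel] by (auto simp: space_prob_algebra)

lemma space_N_not_empty: "space N \<noteq> {}"
  using prior.not_empty \<Psi>_onto by auto

text \<open>The disintegration identity with \<open>B = space N\<close>. In this form integrals over
  the prior become iterated integrals through \<open>nn_integral_bind\<close>.\<close>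

lemma prior_eq_bind: "\<pi> = distr \<pi> N \<Psi> \<bind> K"
proof (rule measure_eqI)
  have K': "K \<in> measurable (distr \<pi> N \<Psi>) (subprob_algebra \<pi>)" using K_subprob by simp
  have ne: "space (distr \<pi> N \<Psi>) \<noteq> {}" using space_N_not_empty by simp
  show "sets \<pi> = sets (distr \<pi> N \<Psi> \<bind> K)"
    using sets_bind[OF sets_kernel[OF K'] ne] by simp
  fix A assume A: "A \<in> sets \<pi>"
  have "A \<inter> \<Psi> -` space N = A"
    using sets.sets_into_space[OF A] \<Psi>_onto by auto
  then have "emeasure \<pi> A = (\<integral>\<^sup>+\<psi>\<in>space N. emeasure (K \<psi>) A \<partial>distr \<pi> N \<Psi>)"
    using K_disintegration[OF A sets.top] by simp
  also have "\<dots> = (\<integral>\<^sup>+\<psi>. emeasure (K \<psi>) A \<partial>distr \<pi> N \<Psi>)"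
    by (rule nn_integral_cong) simp
  also have "\<dots> = emeasure (distr \<pi> N \<Psi> \<bind> K) A"
    by (rule emeasure_bind[OF ne K' A, symmetric])
  finally show "emeasure \<pi> A = emeasure (distr \<pi> N \<Psi> \<bind> K) A" .
qed

lemma f_measurable_cong:
  assumes "sets P = sets \<pi>"
  shows "(\<lambda>(\<theta>, x). ennreal (f \<theta> x)) \<in> borel_measurable (P \<Otimes>\<^sub>M \<mu>)"
proof -
  have "(\<lambda>(\<theta>, x). f \<theta> x) \<in> borel_measurable (P \<Otimes>\<^sub>M \<mu>)"
    using f_measurable by (simp cong: measurable_cong_sets sets_pair_measure_cong add: assms)
  then show ?thesis by (simp add: case_prod_beta)
qed

lemma predictive_density_measurable:
  assumes "prob_space P" "sets P = sets \<pi>"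
  shows "predictive_density f P \<in> borel_measurable \<mu>"
proof -
  interpret P: prob_space P by fact
  note [measurable] = f_measurable_cong[OF assms(2)]
  show ?thesis unfolding predictive_density_def[abs_def] by measurable
qed

text \<open>Tonelli: the predictive probability of \<open>A\<close> becomes the integral against
  \<open>P\<close> of a function of \<theta> that does not depend on \<open>P\<close>, so that
  different mixing measures can be compared.\<close>

lemma emeasure_predictive:
  assumes P: "prob_space P" "sets P = sets \<pi>" and A[measurable]: "A \<in> sets \<mu>"
  shows "emeasure (predictive \<mu> f P) A = (\<integral>\<^sup>+\<theta>. (\<integral>\<^sup>+x\<in>A. ennreal (f \<theta> x) \<partial>\<mu>) \<partial>P)"
proof -
  interpret P: prob_space P by fact
  interpret pair_sigma_finite P \<mu> ..
  note [measurable] = f_measurable_cong[OF P(2)]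
  note [measurable] = predictive_density_measurable[OF P]
  have "emeasure (predictive \<mu> f P) A = (\<integral>\<^sup>+x. (\<integral>\<^sup>+\<theta>. ennreal (f \<theta> x) \<partial>P) * indicator A x \<partial>\<mu>)"
    unfolding predictive_def by (simp add: emeasure_density) (simp add: predictive_density_def)
  also have "\<dots> = (\<integral>\<^sup>+x. (\<integral>\<^sup>+\<theta>. ennreal (f \<theta> x) * indicator A x \<partial>P) \<partial>\<mu>)"
    by (intro nn_integral_cong nn_integral_multc[symmetric]) measurable
  also have "\<dots> = (\<integral>\<^sup>+\<theta>. (\<integral>\<^sup>+x. ennreal (f \<theta> x) * indicator A x \<partial>\<mu>) \<partial>P)"
    by (rule Fubini') measurable
  finally show ?thesis .
qed

text \<open>Each \<open>f \<theta>\<close> has total mass 1, so the bound is 1. Finiteness is what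
  later permits cancellation in \<open>ennreal\<close>.\<close>

lemma emeasure_predictive_finite:
  assumes P: "prob_space P" "sets P = sets \<pi>" and A: "A \<in> sets \<mu>"
  shows "emeasure (predictive \<mu> f P) A < \<top>"
proof -
  interpret P: prob_space P by fact
  have "emeasure (predictive \<mu> f P) A \<le> (\<integral>\<^sup>+\<theta>. 1 \<partial>P)"
    unfolding emeasure_predictive[OF P A]
  proof (rule nn_integral_mono)
    fix \<theta> assume "\<theta> \<in> space P"
    then have "\<theta> \<in> space \<pi>" using sets_eq_imp_space_eq[OF P(2)] by simp
    have "(\<integral>\<^sup>+x\<in>A. ennreal (f \<theta> x) \<partial>\<mu>) \<le> (\<integral>\<^sup>+x. ennreal (f \<theta> x) \<partial>\<mu>)"
      by (rule nn_integral_mono) (auto simp: indicator_def)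
    then show "(\<integral>\<^sup>+x\<in>A. ennreal (f \<theta> x) \<partial>\<mu>) \<le> 1"
      using f_density[OF \<open>\<theta> \<in> space \<pi>\<close>] by simp
  qed
  also have "\<dots> < \<top>" by (simp add: P.emeasure_space_1)
  finally show ?thesis .
qed

lemma emeasure_predictive_K:
  assumes A[measurable]: "A \<in> sets \<mu>"
  shows "(\<lambda>\<psi>. emeasure (predictive \<mu> f (K \<psi>)) A) \<in> borel_measurable N"
    and "emeasure (predictive \<mu> f \<pi>) A =
      (\<integral>\<^sup>+\<psi>. emeasure (predictive \<mu> f (K \<psi>)) A \<partial>distr \<pi> N \<Psi>)"
proof -
  \<comment> \<open>The sampling probability of \<open>A\<close> under \<theta>. Both M(A) and M(A |
    \<psi>) are integrals of this one function, against \<open>\<pi>\<close> and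
    \<open>K \<psi>\<close>.\<close>
  define g where "g = (\<lambda>\<theta>. \<integral>\<^sup>+x\<in>A. ennreal (f \<theta> x) \<partial>\<mu>)"
  note [measurable] = f_measurable_cong[OF refl]
  have g: "g \<in> borel_measurable \<pi>" unfolding g_def by measurable
  have eq: "emeasure (predictive \<mu> f (K \<psi>)) A = (\<integral>\<^sup>+\<theta>. g \<theta> \<partial>K \<psi>)" if "\<psi> \<in> space N" for \<psi>
    unfolding g_def by (rule emeasure_predictive[OF prob_space_K[OF that] sets_K[OF that] A])
  have "(\<lambda>\<psi>. \<integral>\<^sup>+\<theta>. g \<theta> \<partial>K \<psi>) \<in> borel_measurable N"
    by (rule measurable_compose[OF K_subprob nn_integral_measurable_subprob_algebra[OF g]])
  then show "(\<lambda>\<psi>. emeasure (predictive \<mu> f (K \<psi>)) A) \<in> borel_measurable N"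
    by (simp add: eq cong: measurable_cong)
  have "emeasure (predictive \<mu> f \<pi>) A = (\<integral>\<^sup>+\<theta>. g \<theta> \<partial>(distr \<pi> N \<Psi> \<bind> K))"
    unfolding prior_eq_bind[symmetric] g_def
    by (rule emeasure_predictive[OF prior.prob_space_axioms refl A])
  also have "\<dots> = (\<integral>\<^sup>+\<psi>. (\<integral>\<^sup>+\<theta>. g \<theta> \<partial>K \<psi>) \<partial>distr \<pi> N \<Psi>)"
    using K_subprob by (intro nn_integral_bind[OF g]) simp
  also have "\<dots> = (\<integral>\<^sup>+\<psi>. emeasure (predictive \<mu> f (K \<psi>)) A \<partial>distr \<pi> N \<Psi>)"
    by (rule nn_integral_cong) (simp add: eq)
  finally show "emeasure (predictive \<mu> f \<pi>) A =
      (\<integral>\<^sup>+\<psi>. emeasure (predictive \<mu> f (K \<psi>)) A \<partial>distr \<pi> N \<Psi>)" .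
qed

text \<open>Comparing the two predictive densities directly avoids the division in
  \<open>RB\<close>. Each is jointly measurable in data and parameter value, the conditional one as
  an integral against the kernel \<open>K\<close>.\<close>

lemma is_region_plausible_region: "is_region \<mu> N (plausible_region \<pi> f N K)"
proof -
  note [measurable] = predictive_density_measurable[OF prior.prob_space_axioms refl]
    and [measurable] = f_measurable_cong[OF refl]
  have [measurable]: "(\<lambda>z. predictive_density f (K (snd z)) (fst z)) \<in> borel_measurable (\<mu> \<Otimes>\<^sub>M N)"
    unfolding predictive_density_def
    by (rule nn_integral_measurable_subprob_algebra2[where N = \<pi>])
      (measurable, rule measurable_compose[OF measurable_snd K_subprob])
  have "{(x, \<psi>) \<in> space \<mu> \<times> space N. \<psi> \<in> plausible_region \<pi> f N K x} =
      {z \<in> space (\<mu> \<Otimes>\<^sub>M N).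
        predictive_density f \<pi> (fst z) < predictive_density f (K (snd z)) (fst z)}"
    by (auto simp: plausible_region_def one_less_RB_iff space_pair_measure)
  also have "\<dots> \<in> sets (\<mu> \<Otimes>\<^sub>M N)" by measurable
  finally show ?thesis by (auto simp: is_region_def plausible_region_def)
qed

lemma region_miss_sets:
  assumes C: "is_region \<mu> N C" and \<psi>: "\<psi> \<in> space N"
  shows "{x \<in> space \<mu>. \<psi> \<notin> C x} \<in> sets \<mu>"
proof -
  let ?R = "{(x, \<psi>) \<in> space \<mu> \<times> space N. \<psi> \<in> C x}"
  have "(\<lambda>x. (x, \<psi>)) -` ?R \<inter> space \<mu> \<in> sets \<mu>"
    using C \<psi> by (intro measurable_sets[OF measurable_Pair2']) (auto simp: is_region_def)
  moreover have "{x \<in> space \<mu>. \<psi> \<notin> C x} = space \<mu> - ((\<lambda>x. (x, \<psi>)) -` ?R \<inter> space \<mu>)"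
    using \<psi> by auto
  ultimately show ?thesis by auto
qed

text \<open>Neyman-Pearson at a fixed \<psi>, with the prior predictive density as \<open>p\<close>
  and the conditional one given \<psi> as \<open>q\<close>.\<close>

lemma noncover_le_plausible_region:
  assumes C: "is_region \<mu> N C" and \<psi>: "\<psi> \<in> space N"
    and le: "noncover \<mu> f (K \<psi>) C \<psi> \<le> noncover \<mu> f (K \<psi>) (plausible_region \<pi> f N K) \<psi>"
  shows "noncover \<mu> f \<pi> C \<psi> \<le> noncover \<mu> f \<pi> (plausible_region \<pi> f N K) \<psi>"
  unfolding noncover_def predictive_def
proof (rule neyman_pearson_le)
  let ?B = "{x \<in> space \<mu>. \<psi> \<notin> plausible_region \<pi> f N K x}"
  show "predictive_density f \<pi> \<in> borel_measurable \<mu>"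
    by (rule predictive_density_measurable[OF prior.prob_space_axioms refl])
  show "predictive_density f (K \<psi>) \<in> borel_measurable \<mu>"
    by (rule predictive_density_measurable[OF prob_space_K[OF \<psi>] sets_K[OF \<psi>]])
  show "{x \<in> space \<mu>. \<psi> \<notin> C x} \<in> sets \<mu>" by (rule region_miss_sets[OF C \<psi>])
  show B: "?B \<in> sets \<mu>" by (rule region_miss_sets[OF is_region_plausible_region \<psi>])
  show "x \<in> ?B \<longleftrightarrow> predictive_density f (K \<psi>) x \<le> predictive_density f \<pi> x"
    if "x \<in> space \<mu>" for x
    using that \<psi> by (simp add: plausible_region_def one_less_RB_iff not_less)
  show "emeasure (density \<mu> (predictive_density f (K \<psi>))) {x \<in> space \<mu>. \<psi> \<notin> C x}
      \<le> emeasure (density \<mu> (predictive_density f (K \<psi>))) ?B"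
    using le by (simp add: noncover_def predictive_def)
  show "emeasure (density \<mu> (predictive_density f (K \<psi>))) ?B < \<top>"
    using emeasure_predictive_finite[OF prob_space_K[OF \<psi>] sets_K[OF \<psi>] B]
    by (simp add: predictive_def)
qed

lemma prior_noncover_le_plausible_region:
  assumes "is_region \<mu> N C"
    and "\<And>\<psi>. \<psi> \<in> space N \<Longrightarrow>
      noncover \<mu> f (K \<psi>) C \<psi> \<le> noncover \<mu> f (K \<psi>) (plausible_region \<pi> f N K) \<psi>"
  shows "prior_noncover \<mu> \<pi> f N \<Psi> C \<le> prior_noncover \<mu> \<pi> f N \<Psi> (plausible_region \<pi> f N K)"
  unfolding prior_noncover_def
  using assms by (intro nn_integral_mono noncover_le_plausible_region) auto

lemma noncover_split_true_value:
  assumes C: "is_region \<mu> N C" and \<psi>: "\<psi> \<in> space N"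
  shows "noncover \<mu> f \<pi> C \<psi> =
    noncover \<mu> f (K \<psi>) C \<psi> * emeasure (distr \<pi> N \<Psi>) {\<psi>} +
    (\<integral>\<^sup>+\<psi>'\<in>space N - {\<psi>}. noncover \<mu> f (K \<psi>') C \<psi> \<partial>distr \<pi> N \<Psi>)"
proof -
  let ?h = "\<lambda>\<psi>'. noncover \<mu> f (K \<psi>') C \<psi>"
  note [measurable] = singleton_sets[OF \<psi>]
  note A = region_miss_sets[OF C \<psi>]
  have h[measurable]: "?h \<in> borel_measurable N"
    unfolding noncover_def by (rule emeasure_predictive_K(1)[OF A])
  have "noncover \<mu> f \<pi> C \<psi> = (\<integral>\<^sup>+\<psi>'. ?h \<psi>' \<partial>distr \<pi> N \<Psi>)"
    unfolding noncover_def by (rule emeasure_predictive_K(2)[OF A])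
  \<comment> \<open>On the singleton the integrand is replaced by its value at \<psi>, so the first
    summand is a constant times an indicator.\<close>
  also have "\<dots> = (\<integral>\<^sup>+\<psi>'. ?h \<psi> * indicator {\<psi>} \<psi>' + ?h \<psi>' * indicator (space N - {\<psi>}) \<psi>'
      \<partial>distr \<pi> N \<Psi>)"
    by (rule nn_integral_cong) (auto simp: indicator_def)
  also have "\<dots> = ?h \<psi> * emeasure (distr \<pi> N \<Psi>) {\<psi>} +
      (\<integral>\<^sup>+\<psi>'\<in>space N - {\<psi>}. ?h \<psi>' \<partial>distr \<pi> N \<Psi>)"
    by (subst nn_integral_add) (auto simp: nn_integral_cmult_indicator)
  finally show ?thesis .
qed

text \<open>Serves both cases of (ii): \<open>eq\<close> is demanded only at atoms of the marginal
  prior, so it is vacuous if there are none and follows from the equality constraint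
  otherwise.\<close>

lemma prior_noncover_false_le_plausible_region:
  assumes C: "is_region \<mu> N C"
    and le: "\<And>\<psi>. \<psi> \<in> space N \<Longrightarrow>
      noncover \<mu> f (K \<psi>) C \<psi> \<le> noncover \<mu> f (K \<psi>) (plausible_region \<pi> f N K) \<psi>"
    and eq: "\<And>\<psi>. \<psi> \<in> space N \<Longrightarrow> emeasure (distr \<pi> N \<Psi>) {\<psi>} \<noteq> 0 \<Longrightarrow>
      noncover \<mu> f (K \<psi>) C \<psi> = noncover \<mu> f (K \<psi>) (plausible_region \<pi> f N K) \<psi>"
  shows "prior_noncover_false \<mu> \<pi> f N \<Psi> K C \<le>
    prior_noncover_false \<mu> \<pi> f N \<Psi> K (plausible_region \<pi> f N K)"
  unfolding prior_noncover_false_def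
proof (rule nn_integral_mono)
  let ?Pl = "plausible_region \<pi> f N K"
  fix \<psi> assume "\<psi> \<in> space (distr \<pi> N \<Psi>)"
  then have \<psi>: "\<psi> \<in> space N" by simp
  interpret marginal: prob_space "distr \<pi> N \<Psi>"
    by (rule prior.prob_space_distr[OF \<Psi>_measurable])
  let ?c = "noncover \<mu> f (K \<psi>) C \<psi> * emeasure (distr \<pi> N \<Psi>) {\<psi>}"
  \<comment> \<open>At a non-atom both products vanish; at an atom \<open>eq\<close>
    applies.\<close>
  have c: "?c = noncover \<mu> f (K \<psi>) ?Pl \<psi> * emeasure (distr \<pi> N \<Psi>) {\<psi>}"
    using eq[OF \<psi>] by (cases "emeasure (distr \<pi> N \<Psi>) {\<psi>} = 0") auto
  have "noncover \<mu> f (K \<psi>) C \<psi> < \<top>"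
    unfolding noncover_def
    by (rule emeasure_predictive_finite[OF prob_space_K[OF \<psi>] sets_K[OF \<psi>] region_miss_sets[OF C \<psi>]])
  \<comment> \<open>The contribution of the true value is finite and common to both regions, so it
    cancels from the comparison of total noncoverage, leaving that of the false values.\<close>
  then have "?c \<noteq> \<top>" by (simp add: ennreal_mult_eq_top_iff marginal.emeasure_finite)
  then show "(\<integral>\<^sup>+\<psi>'\<in>space N - {\<psi>}. noncover \<mu> f (K \<psi>') C \<psi> \<partial>distr \<pi> N \<Psi>)
      \<le> (\<integral>\<^sup>+\<psi>'\<in>space N - {\<psi>}. noncover \<mu> f (K \<psi>') ?Pl \<psi> \<partial>distr \<pi> N \<Psi>)"
    using noncover_le_plausible_region[OF C \<psi> le[OF \<psi>]]
    by (simp add: noncover_split_true_value[OF C \<psi>] c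
        noncover_split_true_value[OF is_region_plausible_region \<psi>])
qed

end

theorem theorem2:
  fixes \<mu> :: "'x measure" and \<pi> :: "'t measure" and f :: "'t \<Rightarrow> 'x \<Rightarrow> real"
    and N :: "'p measure" and \<Psi> :: "'t \<Rightarrow> 'p" and K :: "'p \<Rightarrow> 't measure"
  assumes "relative_belief_model \<mu> \<pi> f N \<Psi> K"
  shows
    "is_arg_max (prior_noncover \<mu> \<pi> f N \<Psi>)
       (\<lambda>C. is_region \<mu> N C \<and> (\<forall>\<psi>'\<in>space N.
          noncover \<mu> f (K \<psi>') C \<psi>' \<le> noncover \<mu> f (K \<psi>') (plausible_region \<pi> f N K) \<psi>'))
       (plausible_region \<pi> f N K)
   \<and> ((\<forall>\<psi>'\<in>space N. emeasure (distr \<pi> N \<Psi>) {\<psi>'} = 0) \<longrightarrow>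
     is_arg_max (prior_noncover_false \<mu> \<pi> f N \<Psi> K)
       (\<lambda>C. is_region \<mu> N C \<and> (\<forall>\<psi>'\<in>space N.
          noncover \<mu> f (K \<psi>') C \<psi>' \<le> noncover \<mu> f (K \<psi>') (plausible_region \<pi> f N K) \<psi>'))
       (plausible_region \<pi> f N K))
   \<and> (\<not> (\<forall>\<psi>'\<in>space N. emeasure (distr \<pi> N \<Psi>) {\<psi>'} = 0) \<longrightarrow>
     is_arg_max (prior_noncover_false \<mu> \<pi> f N \<Psi> K)
       (\<lambda>C. is_region \<mu> N C \<and> (\<forall>\<psi>'\<in>space N.
          noncover \<mu> f (K \<psi>') C \<psi>' = noncover \<mu> f (K \<psi>') (plausible_region \<pi> f N K) \<psi>'))
       (plausible_region \<pi> f N K))"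
proof -
  interpret relative_belief_model \<mu> \<pi> f N \<Psi> K by fact
  \<comment> \<open>The plausible region is feasible because it is a region and meets its own
    constraint with equality. Since \<open>ennreal\<close> is linearly ordered, having no strictly
    better region means that every feasible value is bounded by that of the plausible
    region.\<close>
  show ?thesis
    unfolding is_arg_max_def
    by (auto simp: not_less is_region_plausible_region
        intro!: prior_noncover_le_plausible_region prior_noncover_false_le_plausible_region)
qed

end
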